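(* Let $b\in L$, let $p\in L$ be a proper element, and let $n\geqslant 2$ be an integer. Consider the following statements: (a) $b$ is $\delta$-primary to $p$. (b) $b$ is $\phi_0$-$\delta$-primary to $p$. (c) $b$ is $\phi_\omega$-$\delta$-primary to $p$. (d) $b$ is $\phi_{n+1}$-$\delta$-primary to $p$. (e) $b$ is $\phi_n$-$\delta$-primary to $p$. (f) $b$ is $\phi_2$-$\delta$-primary to $p$. Then $(a)\Rightarrow(b)\Rightarrow(c)\Rightarrow(d)\Rightarrow(e)\Rightarrow(f)$.
   Context: A multiplicative lattice is a complete lattice (least element $0$, largest element $1$) with a commutative, associative multiplication that distributes over arbitrary joins and has $1$ as multiplicative identity. An element $a$ is compact if whenever $a\leqslant \vee X$ for $X\subseteq L$ there are finitely many $a_1,\dots,a_n\in X$ with $a\leqslant a_1\vee\cdots\vee a_n$. Standing assumptions: $L$ is a compactly generated multiplicative lattice (every element is a join of compact elements), $1$ is compact, and every finite product of compact elements is compact. An element $p$ is proper if $p<1$. $\delta:L\to L$ is an expansion function: $a\leqslant\delta(a)$ for all $a$, and $a\leqslant b$ implies $\delta(a)\leqslant\delta(b)$. An element $b\in L$ is $\delta$-primary to a proper element $p$ if for all $x\in L$, $xb\leqslant p$ implies $x\leqslant\delta(p)$. For a function $\phi:L\to L$, $b$ is $\phi$-$\delta$-primary to a proper element $p$ if for all $x\in L$, $xb\leqslant p$ and $xb\not\leqslant\phi(p)$ implies $x\leqslant\delta(p)$. Special functions: $\phi_0(p)=0$, $\phi_n(p)=p^n$ for $n\geqslant 2$, and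 $\phi_\omega(p)=\bigwedge_{n=1}^{\infty}p^n$. *)

theory Defs
  imports Main
begin

text \<open>
  The largest element of a multiplicative lattice is written both \<open>top\<close> and \<open>1\<close>; its least
  element, the paper's $0$, is \<open>bot\<close>.
\<close>

class multiplicative_lattice = complete_lattice + comm_monoid_mult +
  assumes one_eq_top: "1 = top"
    and mult_Sup_distrib: "a * Sup X = (SUP x\<in>X. a * x)"

text \<open>
  The finite subfamily may be empty, which matters only for \<open>X = {}\<close>: then \<open>a = bot\<close>, and
  \<open>bot\<close> is compact, being the empty join.
\<close>

definition (in complete_lattice) compact_element :: "'a \<Rightarrow> bool" where
  "compact_element a \<longleftrightarrow>
    (\<forall>X. a \<le> Sup X \<longrightarrow> (\<exists>F. finite F \<and> F \<subseteq> X \<and> a \<le> Sup F))"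

class compactly_generated_multiplicative_lattice = multiplicative_lattice +
  assumes compactly_generated: "\<exists>X. (\<forall>x\<in>X. compact_element x) \<and> a = Sup X"
    and compact_one: "compact_element 1"
    and compact_prod_list: "(\<forall>x\<in>set xs. compact_element x) \<Longrightarrow> compact_element (prod_list xs)"

definition proper_element :: "'a::multiplicative_lattice \<Rightarrow> bool" where
  "proper_element p \<longleftrightarrow> p < 1"

definition expansion_function :: "('a::multiplicative_lattice \<Rightarrow> 'a) \<Rightarrow> bool" where
  "expansion_function \<delta> \<longleftrightarrow> (\<forall>a. a \<le> \<delta> a) \<and> (\<forall>a b. a \<le> b \<longrightarrow> \<delta> a \<le> \<delta> b)"

definition delta_primary_to ::
    "('a::multiplicative_lattice \<Rightarrow> 'a) \<Rightarrow> 'a \<Rightarrow> 'a \<Rightarrow> bool" where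
  "delta_primary_to \<delta> b p \<longleftrightarrow>
    proper_element p \<and> (\<forall>x. x * b \<le> p \<longrightarrow> x \<le> \<delta> p)"

definition phi_delta_primary_to ::
    "('a::multiplicative_lattice \<Rightarrow> 'a) \<Rightarrow> ('a \<Rightarrow> 'a) \<Rightarrow> 'a \<Rightarrow> 'a \<Rightarrow> bool" where
  "phi_delta_primary_to \<phi> \<delta> b p \<longleftrightarrow>
    proper_element p \<and> (\<forall>x. x * b \<le> p \<and> \<not> x * b \<le> \<phi> p \<longrightarrow> x \<le> \<delta> p)"

definition phi_zero :: "'a::multiplicative_lattice \<Rightarrow> 'a" where
  "phi_zero p = bot"

text \<open>Only exponents \<open>n \<ge> 2\<close> give the paper's $\phi_n$; its $\phi_0$ is \<open>phi_zero\<close>, not the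
  power \<open>p ^ 0 = 1\<close>.\<close>

definition phi_pow :: "nat \<Rightarrow> 'a::multiplicative_lattice \<Rightarrow> 'a" where
  "phi_pow n p = p ^ n"

definition phi_omega :: "'a::multiplicative_lattice \<Rightarrow> 'a" where
  "phi_omega p = (INF n\<in>{1::nat..}. p ^ n)"

end

theory Submission
  imports Defs
begin

text \<open>
  Being \<open>\<phi>\<close>-\<open>\<delta>\<close>-primary to \<open>p\<close> only weakens when \<open>\<phi> p\<close> grows, and
  $0 \le \bigwedge_m p^m \le p^{n+1} \le p^n \le p^2$.
\<close>

lemma phi_delta_primary_to_mono:
  assumes "phi_delta_primary_to \<phi> \<delta> b p" and "\<phi> p \<le> \<psi> p"
  shows "phi_delta_primary_to \<psi> \<delta> b p"
  using assms order_trans unfolding phi_delta_primary_to_def by blast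

text \<open>Monotonicity comes from distributivity: \<open>x \<le> y\<close> makes \<open>y\<close>
  the join of \<open>{x, y}\<close>, so \<open>a * y\<close> is the join of \<open>a * x\<close> and
  \<open>a * y\<close>.\<close>

lemma mult_left_mono_lattice:
  fixes a x y :: "'a::multiplicative_lattice"
  assumes "x \<le> y"
  shows "a * x \<le> a * y"
proof -
  have "a * y = a * Sup {x, y}"
    using assms by (simp add: sup_absorb2)
  also have "\<dots> = sup (a * x) (a * y)"
    \<comment> \<open>The product is distributed while \<open>Sup {x, y}\<close> is still a set
      join; only then is the join over two elements evaluated.\<close>
    by (simp only: mult_Sup_distrib) simp
  finally show ?thesis
    by (simp add: le_iff_sup)
qed

text \<open>The element \<open>1\<close> is both the top and the identity, so enlarging the factor
  \<open>a\<close> to \<open>1\<close> leaves just \<open>b\<close>.\<close>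

lemma mult_le_right:
  fixes a b :: "'a::multiplicative_lattice"
  shows "a * b \<le> b"
proof -
  have "b * a \<le> b * 1"
    by (rule mult_left_mono_lattice) (simp add: one_eq_top)
  then show ?thesis
    by (simp add: mult.commute)
qed

text \<open>Split \<open>p ^ n\<close> as \<open>p ^ (n - m) * p ^ m\<close> and drop the left
  factor.\<close>

lemma power_antimono_exponent:
  fixes p :: "'a::multiplicative_lattice"
  assumes "m \<le> n"
  shows "p ^ n \<le> p ^ m"
  using assms by (metis le_add_diff_inverse2 mult_le_right power_add)

theorem theorem2p12:
  fixes b p :: "'a::compactly_generated_multiplicative_lattice"
    and \<delta> :: "'a \<Rightarrow> 'a"
    and n :: nat
  assumes "expansion_function \<delta>"
    and "proper_element p"
    and "n \<ge> 2"
  shows "(delta_primary_to \<delta> b p \<longrightarrow> phi_delta_primary_to phi_zero \<delta> b p) \<and>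
    (phi_delta_primary_to phi_zero \<delta> b p \<longrightarrow> phi_delta_primary_to phi_omega \<delta> b p) \<and>
    (phi_delta_primary_to phi_omega \<delta> b p \<longrightarrow> phi_delta_primary_to (phi_pow (n + 1)) \<delta> b p) \<and>
    (phi_delta_primary_to (phi_pow (n + 1)) \<delta> b p \<longrightarrow> phi_delta_primary_to (phi_pow n) \<delta> b p) \<and>
    (phi_delta_primary_to (phi_pow n) \<delta> b p \<longrightarrow> phi_delta_primary_to (phi_pow 2) \<delta> b p)"
proof (intro conjI impI)
  assume "delta_primary_to \<delta> b p"
  then show "phi_delta_primary_to phi_zero \<delta> b p"
    \<comment> \<open>This works for every \<phi>: the condition on \<open>\<phi> p\<close> only
      narrows the range of \<open>x\<close> to be tested.\<close>
    by (simp add: delta_primary_to_def phi_delta_primary_to_def)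
next
  assume "phi_delta_primary_to phi_zero \<delta> b p"
  then show "phi_delta_primary_to phi_omega \<delta> b p"
    by (rule phi_delta_primary_to_mono) (simp add: phi_zero_def)
next
  assume "phi_delta_primary_to phi_omega \<delta> b p"
  then show "phi_delta_primary_to (phi_pow (n + 1)) \<delta> b p"
    by (rule phi_delta_primary_to_mono)
      \<comment> \<open>The meet runs over exponents from 1 on, so \<open>p ^ (n + 1)\<close> is one
        of its terms.\<close>
      (unfold phi_omega_def phi_pow_def, rule INF_lower, simp)
next
  assume "phi_delta_primary_to (phi_pow (n + 1)) \<delta> b p"
  then show "phi_delta_primary_to (phi_pow n) \<delta> b p"
    by (rule phi_delta_primary_to_mono)
      (unfold phi_pow_def, rule power_antimono_exponent, simp)
next
  assume "phi_delta_primary_to (phi_pow n) \<delta> b p"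
  then show "phi_delta_primary_to (phi_pow 2) \<delta> b p"
    by (rule phi_delta_primary_to_mono)
      \<comment> \<open>Here \<open>n \<ge> 2\<close> enters, giving
        \<open>p ^ n \<le> p ^ 2\<close>.\<close>
      (unfold phi_pow_def, rule power_antimono_exponent, rule \<open>n \<ge> 2\<close>)
qed

end
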